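(* Let $M,n\in\mathbb{N}$ and let $\phi\in L^2(\mathbb{H})$ be supported in $[0,2n]\times[0,n]\times[0,M]$. Assume that the system $\{L_{(2k,l,m)}\phi:k,l,m\in\mathbb{Z}\}$ forms a Riesz sequence. Let $Q:=[0,2]\times[0,1]\times[0,1]$ and $$A:=\{(k,l,m)\in\mathbb{Z}^3:\ -(n-1)\leq k,l\leq 0,\ -M-n+1<m<n\}.$$ Then the following statements are equivalent: (i) The system $\{L_{(2k,l,m)}\phi:k,l,m\in\mathbb{Z}\}$ has a generalized dual $\{L_{(2k,l,m)}\widetilde{\phi}:k,l,m\in\mathbb{Z}\}$, for some $\widetilde\phi\in L^2(\mathbb{H})$ with $\operatorname{supp}\widetilde{\phi}\subset Q$. (ii) If $\sum_{(k,l,m)\in A}c_{k,l,m}L_{(2k,l,m)}\phi(x,y,t)=0$ for all $(x,y,t)\in Q$ and for some coefficients $\{c_{k,l,m}\}$, then $c_{0,0,0}=0$. (iii) $\phi|_Q\notin\operatorname{span}\left\{(L_{(2k,l,m)}\phi)|_Q:(k,l,m)\in A\setminus\{(0,0,0)\}\right\}$. In case any one of these conditions is satisfied, the generalized duals $\{L_{(2k,l,m)}\widetilde{\phi}:k,l,m\in\mathbb{Z}\}$ in (i) (with $\operatorname{supp}\widetilde\phi\subset Q$) form orthogonal sequences and they are oblique duals of $\{L_{(2k,l,m)}\phi:k,l,m\in\mathbb{Z}\}$. Moreover, one can choose $\widetilde{\phi}$ to be of the form $$\widetilde{\phi}=\bigg[\sum_{(k,l,m)\in A}d_{k,l,m}L_{(2k,l,m)}\phi\bigg]\chi_Q$$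 for some coefficients $\{d_{k,l,m}\}$, where $\chi_Q$ denotes the characteristic function of $Q$.
   Context: The Heisenberg group $\mathbb{H}$ is $\mathbb{R}\times\mathbb{R}\times\mathbb{R}$ with group law $(x,y,t)(x',y',t')=(x+x',y+y',t+t'+\tfrac12(x'y-y'x))$; its Haar measure is Lebesgue measure $dx\,dy\,dt$. For $(u,v,s)\in\mathbb{H}$ the left translation operator is $L_{(u,v,s)}f(x,y,t)=f((u,v,s)^{-1}(x,y,t))$, a unitary operator on $L^2(\mathbb{H})$. Pointwise identities between $L^2$ functions are understood in the usual $L^2$ (almost everywhere) sense, and coefficients are complex numbers. Let $\{f_j\}$ be a countable family in a Hilbert space. It is a Riesz sequence if there are $A_0,B_0>0$ with $A_0\|\{c_j\}\|_{\ell^2}^2\le\|\sum_jc_jf_j\|^2\le B_0\|\{c_j\}\|_{\ell^2}^2$ for all finite sequences $\{c_j\}$. It is a frame sequence if there are $A_0,B_0>0$ with $A_0\|f\|^2\le\sum_j|\langle f,f_j\rangle|^2\le B_0\|f\|^2$ for all $f\in\overline{\mathrm{span}\{f_j\}}$. If $\{f_j\}$ is a Riesz sequence, a family $\{g_j\}$ with the same index set is a generalized dual of $\{f_j\}$ if $f=\sum_j\langle f,g_j\rangle f_j$ for all $f\in\overline{\mathrm{span}\{f_j\}}$; if in addition $\{g_j\}$ is a frame sequence, it is called an oblique dual of $\{f_j\}$. *)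

theory Defs
  imports "HOL-Analysis.Analysis"
begin

section \<open>The Heisenberg group\<close>

type_synonym heis = "real \<times> real \<times> real"

definition heis_mult :: "heis \<Rightarrow> heis \<Rightarrow> heis" where
  "heis_mult = (\<lambda>(x, y, t) (x', y', t'). (x + x', y + y', t + t' + 1/2 * (x' * y - y' * x)))"

definition heis_inv :: "heis \<Rightarrow> heis" where
  "heis_inv = (\<lambda>(x, y, t). (- x, - y, - t))"

lemma heis_group_laws:
  "heis_mult (heis_mult a b) c = heis_mult a (heis_mult b c)"
  "heis_mult (0, 0, 0) a = a"
  "heis_mult a (0, 0, 0) = a"
  "heis_mult (heis_inv a) a = (0, 0, 0)"
  "heis_mult a (heis_inv a) = (0, 0, 0)"
  by (auto simp: heis_mult_def heis_inv_def algebra_simps add_divide_distrib diff_divide_distrib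
      split: prod.splits)

definition left_transl :: "heis \<Rightarrow> (heis \<Rightarrow> complex) \<Rightarrow> heis \<Rightarrow> complex" where
  "left_transl u f p = f (heis_mult (heis_inv u) p)"

definition lattice_transl :: "(heis \<Rightarrow> complex) \<Rightarrow> int \<times> int \<times> int \<Rightarrow> heis \<Rightarrow> complex" where
  "lattice_transl f = (\<lambda>(k, l, m). left_transl (2 * of_int k, of_int l, of_int m) f)"


section \<open>Square-integrable functions\<close>

text \<open>
  Elements of \<open>L\<^sup>2(M)\<close> are represented by functions; all notions below are invariant under
  changing the functions on \<open>M\<close>-null sets. With \<open>M = lborel\<close> on \<^typ>\<open>heis\<close>
  this is \<open>L\<^sup>2\<close> for the Haar measure of the Heisenberg group (every class has a Borel
  representative). The restriction of an element to \<open>S\<close> is the same function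
  viewed in \<open>L\<^sup>2\<close> of \<open>restrict_space M S\<close>.
\<close>

definition L2 :: "'a measure \<Rightarrow> ('a \<Rightarrow> complex) set" where
  "L2 M = {f \<in> borel_measurable M. integrable M (\<lambda>x. (cmod (f x))\<^sup>2)}"

definition L2_inner :: "'a measure \<Rightarrow> ('a \<Rightarrow> complex) \<Rightarrow> ('a \<Rightarrow> complex) \<Rightarrow> complex" where
  "L2_inner M f g = (LINT x|M. f x * cnj (g x))"

definition L2_norm :: "'a measure \<Rightarrow> ('a \<Rightarrow> complex) \<Rightarrow> real" where
  "L2_norm M f = sqrt (LINT x|M. (cmod (f x))\<^sup>2)"

text \<open>For closed \<open>S\<close> this says that the (essential) support of \<open>f\<close> is contained in \<open>S\<close>.\<close>

definition supported_in :: "(heis \<Rightarrow> complex) \<Rightarrow> heis set \<Rightarrow> bool" where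
  "supported_in f S \<longleftrightarrow> (AE p in lborel. p \<notin> S \<longrightarrow> f p = 0)"

definition L2_span :: "'a measure \<Rightarrow> ('i \<Rightarrow> 'a \<Rightarrow> complex) \<Rightarrow> 'i set \<Rightarrow> ('a \<Rightarrow> complex) set" where
  "L2_span M f I = {g \<in> L2 M. \<exists>F c. finite F \<and> F \<subseteq> I \<and> (AE x in M. g x = (\<Sum>j\<in>F. c j * f j x))}"

definition L2_closed_span :: "'a measure \<Rightarrow> ('i \<Rightarrow> 'a \<Rightarrow> complex) \<Rightarrow> ('a \<Rightarrow> complex) set" where
  "L2_closed_span M f =
     {g \<in> L2 M. \<forall>e>0. \<exists>h\<in>L2_span M f UNIV. L2_norm M (\<lambda>x. g x - h x) < e}"


section \<open>Riesz sequences, frame sequences and duals\<close>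

definition riesz_seq :: "'a measure \<Rightarrow> ('i::countable \<Rightarrow> 'a \<Rightarrow> complex) \<Rightarrow> bool" where
  "riesz_seq M f \<longleftrightarrow> (\<forall>j. f j \<in> L2 M) \<and>
     (\<exists>A0>0. \<exists>B0>0. \<forall>F c. finite F \<longrightarrow>
        A0 * (\<Sum>j\<in>F. (cmod (c j))\<^sup>2) \<le> (L2_norm M (\<lambda>x. \<Sum>j\<in>F. c j * f j x))\<^sup>2 \<and>
        (L2_norm M (\<lambda>x. \<Sum>j\<in>F. c j * f j x))\<^sup>2 \<le> B0 * (\<Sum>j\<in>F. (cmod (c j))\<^sup>2))"

definition frame_seq :: "'a measure \<Rightarrow> ('i::countable \<Rightarrow> 'a \<Rightarrow> complex) \<Rightarrow> bool" where
  "frame_seq M f \<longleftrightarrow> (\<forall>j. f j \<in> L2 M) \<and>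
     (\<exists>A0>0. \<exists>B0>0. \<forall>h\<in>L2_closed_span M f.
        (\<lambda>j. (cmod (L2_inner M h (f j)))\<^sup>2) summable_on UNIV \<and>
        A0 * (L2_norm M h)\<^sup>2 \<le> (\<Sum>\<^sub>\<infinity>j. (cmod (L2_inner M h (f j)))\<^sup>2) \<and>
        (\<Sum>\<^sub>\<infinity>j. (cmod (L2_inner M h (f j)))\<^sup>2) \<le> B0 * (L2_norm M h)\<^sup>2)"

text \<open>
  The expansion of \<open>h\<close> converges unconditionally in \<open>L\<^sup>2\<close>-norm. For a Riesz sequence, norm
  convergence along one enumeration of the index set already implies this.
\<close>

definition generalized_dual ::
    "'a measure \<Rightarrow> ('i::countable \<Rightarrow> 'a \<Rightarrow> complex) \<Rightarrow> ('i \<Rightarrow> 'a \<Rightarrow> complex) \<Rightarrow> bool" where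
  "generalized_dual M f g \<longleftrightarrow> riesz_seq M f \<and> (\<forall>j. g j \<in> L2 M) \<and>
     (\<forall>h\<in>L2_closed_span M f.
        ((\<lambda>F. L2_norm M (\<lambda>x. h x - (\<Sum>j\<in>F. L2_inner M h (g j) * f j x))) \<longlongrightarrow> 0)
          (finite_subsets_at_top UNIV))"

definition oblique_dual ::
    "'a measure \<Rightarrow> ('i::countable \<Rightarrow> 'a \<Rightarrow> complex) \<Rightarrow> ('i \<Rightarrow> 'a \<Rightarrow> complex) \<Rightarrow> bool" where
  "oblique_dual M f g \<longleftrightarrow> generalized_dual M f g \<and> frame_seq M g"

definition orthogonal_seq :: "'a measure \<Rightarrow> ('i \<Rightarrow> 'a \<Rightarrow> complex) \<Rightarrow> bool" where
  "orthogonal_seq M f \<longleftrightarrow> (\<forall>i j. i \<noteq> j \<longrightarrow> L2_inner M (f i) (f j) = 0)"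


section \<open>The cell \<open>Q\<close> and the index set \<open>A\<close>\<close>

definition Q_cell :: "heis set" where
  "Q_cell = {0..2} \<times> {0..1} \<times> {0..1}"

definition A_index :: "nat \<Rightarrow> nat \<Rightarrow> (int \<times> int \<times> int) set" where
  "A_index M n = {(k, l, m).
     - (int n - 1) \<le> k \<and> k \<le> 0 \<and> - (int n - 1) \<le> l \<and> l \<le> 0 \<and>
     - int M - int n + 1 < m \<and> m < int n}"

end

theory Submission
  imports Defs
begin

text \<open>
  The indices \<open>(2k, l, m)\<close> form a subgroup of the Heisenberg group, and the translates of \<open>Q\<close> by it
  overlap only in null sets. This has two consequences. A nonzero \<open>\<psi>\<close> supported in \<open>Q\<close> has
  pairwise orthogonal lattice translates of equal norm (\<open>lattice_system_in_cell_orthogonal\<close>), so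
  they satisfy Bessel's inequality and form a frame sequence (\<open>orthogonal_bessel\<close>,
  \<open>orthogonal_frame_seq\<close>). And among the translates of \<open>\<phi>\<close> only those indexed by \<open>A\<close> are
  visible on \<open>Q\<close> (\<open>lattice_transl_zero_on_Q_cell\<close>).

  For a Riesz sequence, a dual is a biorthogonal system: the expansion of each \<open>f i\<close> and the
  lower Riesz bound force \<open>\<langle>f i, g j\<rangle> = \<delta> i j\<close> (\<open>generalized_dual_imp_biorthogonal\<close>), and
  conversely biorthogonality together with Bessel's inequality for \<open>g\<close> makes the expansion
  converge on the closed span (\<open>biorthogonal_bessel_imp_generalized_dual\<close>). By translation
  invariance of the inner product, the lattice translates of \<open>\<psi>\<close> are biorthogonal to those of
  \<open>\<phi>\<close> exactly when \<open>\<psi>\<close> has inner product \<open>1\<close> with \<open>\<phi>\<close> and \<open>0\<close> with all its other translates.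

  If \<open>\<psi>\<close> is such a function supported in \<open>Q\<close>, pairing a linear relation on \<open>Q\<close> with \<open>\<psi>\<close> isolates
  the coefficient at the origin, so (i) implies (ii); (ii) and (iii) are the same statement of
  linear algebra. For (iii) implies (i) only the finitely many conditions indexed by \<open>A\<close> matter:
  subtract from \<open>\<phi>\<close> restricted to \<open>Q\<close> its orthogonal projection onto the span of the other
  restricted translates, and normalise. The result is nonzero by (iii), it has the special form
  claimed, and it is dual (\<open>cell_dual_exists\<close>, \<open>cell_dual_properties\<close>).
\<close>

section \<open>Square-integrable functions\<close>

lemma L2_measurable: "f \<in> L2 M \<Longrightarrow> f \<in> borel_measurable M"
  by (simp add: L2_def)

lemma L2_integrable: "f \<in> L2 M \<Longrightarrow> integrable M (\<lambda>x. (cmod (f x))\<^sup>2)"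
  by (simp add: L2_def)

lemma borel_measurable_cnj [measurable (raw)]:
  "f \<in> borel_measurable M \<Longrightarrow> (\<lambda>x. cnj (f x)) \<in> borel_measurable M"
  by (rule borel_measurable_continuous_on[OF _ , of cnj]) (auto intro: continuous_intros)

lemma integrable_mult_cnj:
  assumes "f \<in> L2 M" "g \<in> L2 M"
  shows "integrable M (\<lambda>x. f x * cnj (g x))"
proof (rule Bochner_Integration.integrable_bound)
  show "integrable M (\<lambda>x. (cmod (f x))\<^sup>2 + (cmod (g x))\<^sup>2)"
    using assms by (intro Bochner_Integration.integrable_add L2_integrable)
  show "(\<lambda>x. f x * cnj (g x)) \<in> borel_measurable M"
    using assms[THEN L2_measurable] by (auto intro!: borel_measurable_times borel_measurable_cnj)
  have "a * b \<le> a\<^sup>2 + b\<^sup>2" for a b :: real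
    using sum_squares_bound[of a b] zero_le_power2[of a] zero_le_power2[of b] by linarith
  then show "AE x in M. norm (f x * cnj (g x)) \<le> norm ((cmod (f x))\<^sup>2 + (cmod (g x))\<^sup>2)"
    by (auto simp: norm_mult)
qed

lemma cmod_add_square_le: "(cmod (a + b))\<^sup>2 \<le> 2 * (cmod a)\<^sup>2 + 2 * (cmod b)\<^sup>2"
proof -
  have "(cmod (a + b))\<^sup>2 \<le> (cmod a + cmod b)\<^sup>2"
    by (intro power_mono norm_triangle_ineq) auto
  also have "\<dots> \<le> 2 * (cmod a)\<^sup>2 + 2 * (cmod b)\<^sup>2"
    using sum_squares_bound[of "cmod a" "cmod b"] by (simp add: power2_sum)
  finally show ?thesis .
qed

lemma L2_add:
  assumes "f \<in> L2 M" "g \<in> L2 M"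
  shows "(\<lambda>x. f x + g x) \<in> L2 M"
  unfolding L2_def
proof (intro CollectI conjI)
  show m: "(\<lambda>x. f x + g x) \<in> borel_measurable M"
    using assms[THEN L2_measurable] by auto
  show "integrable M (\<lambda>x. (cmod (f x + g x))\<^sup>2)"
  proof (rule Bochner_Integration.integrable_bound)
    show "integrable M (\<lambda>x. 2 * (cmod (f x))\<^sup>2 + 2 * (cmod (g x))\<^sup>2)"
      using assms by (auto intro!: L2_integrable)
    show "AE x in M. norm ((cmod (f x + g x))\<^sup>2) \<le> norm (2 * (cmod (f x))\<^sup>2 + 2 * (cmod (g x))\<^sup>2)"
      using cmod_add_square_le by auto
  qed (use m in measurable)
qed

lemma L2_scale: "f \<in> L2 M \<Longrightarrow> (\<lambda>x. c * f x) \<in> L2 M"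
  unfolding L2_def by (auto simp: norm_mult power_mult_distrib)

lemma L2_diff:
  assumes "f \<in> L2 M" "g \<in> L2 M"
  shows "(\<lambda>x. f x - g x) \<in> L2 M"
  using L2_add[OF assms(1) L2_scale[OF assms(2), of "-1"]] by simp

lemma L2_zero: "(\<lambda>x. 0) \<in> L2 M"
  by (simp add: L2_def)

lemma L2_sum: "(\<And>j. j \<in> F \<Longrightarrow> f j \<in> L2 M) \<Longrightarrow> (\<lambda>x. \<Sum>j\<in>F. f j x) \<in> L2 M"
  by (induction F rule: infinite_finite_induct) (auto intro: L2_zero L2_add)

lemma L2_lincomb: "(\<And>j. j \<in> F \<Longrightarrow> f j \<in> L2 M) \<Longrightarrow> (\<lambda>x. \<Sum>j\<in>F. c j * f j x) \<in> L2 M"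
  by (intro L2_sum L2_scale)

lemma L2_mult_indicator:
  assumes "f \<in> L2 M" "S \<in> sets M"
  shows "(\<lambda>x. f x * indicator S x) \<in> L2 M"
proof -
  have m: "(\<lambda>x. f x * indicator S x) \<in> borel_measurable M"
    using assms(2) L2_measurable[OF assms(1)] by measurable
  moreover have "integrable M (\<lambda>x. (cmod (f x * indicator S x))\<^sup>2)"
    by (rule Bochner_Integration.integrable_bound[OF L2_integrable[OF assms(1)]])
       (use m in \<open>measurable, auto simp: indicator_def\<close>)
  ultimately show ?thesis by (simp add: L2_def)
qed

lemma L2_norm_nonneg: "0 \<le> L2_norm M f"
  by (simp add: L2_norm_def)

lemma L2_norm_square: "(L2_norm M f)\<^sup>2 = (LINT x|M. (cmod (f x))\<^sup>2)"
  by (simp add: L2_norm_def)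

lemma L2_inner_self: "L2_inner M f f = of_real ((L2_norm M f)\<^sup>2)"
  unfolding L2_inner_def L2_norm_square complex_norm_square[symmetric]
  by (rule integral_complex_of_real)

text \<open>
  A quantitative form of the fact that sums of square-integrable functions are square-integrable.
  It comes from a pointwise inequality, and the factor \<open>2\<close> is harmless wherever only smallness of
  a norm is at stake.
\<close>

lemma L2_norm_square_add_le:
  assumes "f \<in> L2 M" "g \<in> L2 M"
  shows "(L2_norm M (\<lambda>x. f x + g x))\<^sup>2 \<le> 2 * (L2_norm M f)\<^sup>2 + 2 * (L2_norm M g)\<^sup>2"
proof -
  have "(LINT x|M. (cmod (f x + g x))\<^sup>2) \<le> (LINT x|M. 2 * (cmod (f x))\<^sup>2 + 2 * (cmod (g x))\<^sup>2)"
    using assms L2_add[OF assms]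
    by (intro integral_mono cmod_add_square_le Bochner_Integration.integrable_add
        integrable_mult_right L2_integrable)
  then show ?thesis
    using assms by (simp add: L2_norm_square L2_integrable)
qed

lemma L2_norm_cong_AE:
  assumes "f \<in> L2 M" "g \<in> L2 M" "AE x in M. f x = g x"
  shows "L2_norm M f = L2_norm M g"
  unfolding L2_norm_def
  using assms(3) L2_measurable[OF assms(1)] L2_measurable[OF assms(2)]
  by (intro arg_cong[where f = sqrt] integral_cong_AE) auto

lemma L2_norm_zero_imp_AE_zero:
  assumes "f \<in> L2 M" "L2_norm M f = 0"
  shows "AE x in M. f x = 0"
proof -
  have "(LINT x|M. (cmod (f x))\<^sup>2) = 0"
    using assms(2) L2_norm_square[of M f] by simp
  then show ?thesis
    using integral_nonneg_eq_0_iff_AE[OF L2_integrable[OF assms(1)]] by auto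
qed

lemma L2_inner_commute: "L2_inner M g f = cnj (L2_inner M f g)"
  by (simp add: L2_inner_def Bochner_Integration.integral_cnj[symmetric] mult.commute
      del: Bochner_Integration.integral_cnj)

lemma L2_inner_eq_0_AE:
  assumes "f \<in> L2 M" "g \<in> L2 M" "AE x in M. f x * cnj (g x) = 0"
  shows "L2_inner M f g = 0"
proof -
  have "L2_inner M f g = (LINT x|M. 0)"
    unfolding L2_inner_def using assms(3) L2_measurable[OF assms(1)] L2_measurable[OF assms(2)]
    by (intro integral_cong_AE) auto
  then show ?thesis by simp
qed

lemma L2_inner_add_left:
  assumes "f \<in> L2 M" "g \<in> L2 M" "h \<in> L2 M"
  shows "L2_inner M (\<lambda>x. f x + g x) h = L2_inner M f h + L2_inner M g h"
  using assms by (simp add: L2_inner_def distrib_right integrable_mult_cnj)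

lemma L2_inner_scale_left: "L2_inner M (\<lambda>x. c * f x) h = c * L2_inner M f h"
  by (simp add: L2_inner_def mult.assoc)

lemma L2_inner_diff_left:
  assumes "f \<in> L2 M" "g \<in> L2 M" "h \<in> L2 M"
  shows "L2_inner M (\<lambda>x. f x - g x) h = L2_inner M f h - L2_inner M g h"
  using assms by (simp add: L2_inner_def left_diff_distrib integrable_mult_cnj)

lemma L2_inner_lincomb_left:
  assumes "\<And>j. j \<in> F \<Longrightarrow> f j \<in> L2 M" "h \<in> L2 M"
  shows "L2_inner M (\<lambda>x. \<Sum>j\<in>F. c j * f j x) h = (\<Sum>j\<in>F. c j * L2_inner M (f j) h)"
  using assms
proof (induction F rule: infinite_finite_induct)
  case (insert a F)
  then have "L2_inner M (\<lambda>x. c a * f a x + (\<Sum>j\<in>F. c j * f j x)) h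
      = c a * L2_inner M (f a) h + L2_inner M (\<lambda>x. \<Sum>j\<in>F. c j * f j x) h"
    by (simp add: L2_inner_add_left L2_scale L2_lincomb L2_inner_scale_left)
  with insert show ?case by simp
qed (simp_all add: L2_inner_def)

lemma L2_inner_diff_right:
  assumes "f \<in> L2 M" "g \<in> L2 M" "h \<in> L2 M"
  shows "L2_inner M h (\<lambda>x. f x - g x) = L2_inner M h f - L2_inner M h g"
  using L2_inner_diff_left[OF assms] by (metis L2_inner_commute complex_cnj_diff)

lemma L2_inner_lincomb_right:
  assumes "\<And>j. j \<in> F \<Longrightarrow> f j \<in> L2 M" "h \<in> L2 M"
  shows "L2_inner M h (\<lambda>x. \<Sum>j\<in>F. c j * f j x) = (\<Sum>j\<in>F. cnj (c j) * L2_inner M h (f j))"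
proof -
  have "L2_inner M h (\<lambda>x. \<Sum>j\<in>F. c j * f j x) = cnj (L2_inner M (\<lambda>x. \<Sum>j\<in>F. c j * f j x) h)"
    by (rule L2_inner_commute)
  also have "\<dots> = (\<Sum>j\<in>F. cnj (c j) * cnj (L2_inner M (f j) h))"
    using L2_inner_lincomb_left[where F = F, OF assms] by simp
  finally show ?thesis by (simp only: L2_inner_commute[symmetric])
qed

lemma L2_closed_span_approx:
  assumes "h \<in> L2_closed_span M f" "\<And>j. f j \<in> L2 M" "e > 0"
  obtains F c where "finite F" "L2_norm M (\<lambda>x. h x - (\<Sum>j\<in>F. c j * f j x)) < e"
proof -
  from assms(1,3) obtain p where p: "p \<in> L2_span M f UNIV" "L2_norm M (\<lambda>x. h x - p x) < e"
    by (auto simp: L2_closed_span_def)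
  from p(1) obtain F c where F: "finite F" "AE x in M. p x = (\<Sum>j\<in>F. c j * f j x)"
    by (auto simp: L2_span_def)
  have "L2_norm M (\<lambda>x. h x - (\<Sum>j\<in>F. c j * f j x)) = L2_norm M (\<lambda>x. h x - p x)"
    using assms(1,2) p(1) F(2)
    by (intro L2_norm_cong_AE L2_diff L2_lincomb) (auto simp: L2_closed_span_def L2_span_def)
  with p(2) show thesis by (intro that[of F c] F(1)) simp
qed

lemma generator_in_L2_closed_span:
  assumes "f i \<in> L2 M"
  shows "f i \<in> L2_closed_span M f"
proof -
  have "f i \<in> L2_span M f UNIV"
    using assms by (auto simp: L2_span_def intro!: exI[of _ "{i}"] exI[of _ "\<lambda>_. 1"])
  moreover have "L2_norm M (\<lambda>x. f i x - f i x) = 0" by (simp add: L2_norm_def)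
  ultimately show ?thesis
    using assms unfolding L2_closed_span_def by (auto intro!: bexI[of _ "f i"])
qed


section \<open>Orthogonal systems and projections\<close>

text \<open>
  Completing the square in each coefficient: the error of a linear combination splits into the
  error of the best one, with coefficients \<open>\<langle>h, g j\<rangle> / K\<close>, and the distance of the coefficients
  from these. Since both errors are nonnegative, the identity gives both Bessel's inequality and
  the lower frame bound.
\<close>

lemma orthogonal_expansion_error:
  assumes g: "\<And>j. g j \<in> L2 M" "\<And>i j. L2_inner M (g i) (g j) = (if i = j then of_real K else 0)"
    and K: "K > 0" and h: "h \<in> L2 M" and F: "finite F"
  shows "(L2_norm M (\<lambda>x. h x - (\<Sum>j\<in>F. c j * g j x)))\<^sup>2 =
    (L2_norm M h)\<^sup>2 - (\<Sum>j\<in>F. (cmod (L2_inner M h (g j)))\<^sup>2) / K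
      + K * (\<Sum>j\<in>F. (cmod (c j - L2_inner M h (g j) / K))\<^sup>2)"
proof -
  let ?a = "\<lambda>j. L2_inner M h (g j)" and ?p = "\<lambda>x. \<Sum>j\<in>F. c j * g j x"
  have p: "?p \<in> L2 M" by (intro L2_lincomb g)
  have hp: "L2_inner M h ?p = (\<Sum>j\<in>F. cnj (c j) * ?a j)"
    by (intro L2_inner_lincomb_right g h)
  have ph: "L2_inner M ?p h = (\<Sum>j\<in>F. c j * cnj (?a j))"
    using arg_cong[OF hp, of cnj] by (simp add: L2_inner_commute[symmetric])
  have gp: "L2_inner M (g i) ?p = cnj (c i) * K" if "i \<in> F" for i
    using that F by (simp add: L2_inner_lincomb_right[OF g(1) g(1)] g(2) if_distrib cong: if_cong)
  have pp: "L2_inner M ?p ?p = (\<Sum>j\<in>F. c j * (cnj (c j) * K))"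
    by (subst L2_inner_lincomb_left[OF g(1) p]) (simp add: gp)
  have complete_square: "b * (b' * k) - b' * a - b * a' = k * ((b - a / k) * (b' - a' / k)) - a * a' / k"
    if "k \<noteq> 0" for a a' b b' k :: complex
  proof -
    define x y where "x = a / k" and "y = a' / k"
    have "a = k * x" "a' = k * y" using that by (simp_all add: x_def y_def)
    with that show ?thesis by (simp add: algebra_simps)
  qed
  have "complex_of_real ((L2_norm M (\<lambda>x. h x - ?p x))\<^sup>2)
      = L2_inner M h h - L2_inner M h ?p - (L2_inner M ?p h - L2_inner M ?p ?p)"
    by (simp add: L2_inner_self[symmetric] L2_inner_diff_left L2_inner_diff_right h p L2_diff
        del: of_real_power)
  also have "\<dots> = of_real ((L2_norm M h)\<^sup>2)
      + (\<Sum>j\<in>F. c j * (cnj (c j) * K) - cnj (c j) * ?a j - c j * cnj (?a j))"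
    by (simp only: hp ph pp L2_inner_self[of M h] sum_subtractf) simp
  also have "(\<Sum>j\<in>F. c j * (cnj (c j) * K) - cnj (c j) * ?a j - c j * cnj (?a j))
      = (\<Sum>j\<in>F. K * ((c j - ?a j / K) * cnj (c j - ?a j / K)) - ?a j * cnj (?a j) / K)"
    using K by (intro sum.cong refl, subst complete_square) simp_all
  also have "\<dots> = of_real (\<Sum>j\<in>F. K * (cmod (c j - ?a j / K))\<^sup>2 - (cmod (?a j))\<^sup>2 / K)"
    by (simp only: complex_norm_square[symmetric] of_real_sum of_real_diff of_real_mult of_real_divide)
  finally have "(L2_norm M (\<lambda>x. h x - ?p x))\<^sup>2 = (L2_norm M h)\<^sup>2
      + (\<Sum>j\<in>F. K * (cmod (c j - ?a j / K))\<^sup>2 - (cmod (?a j))\<^sup>2 / K)"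
    by (simp only: of_real_add[symmetric] of_real_eq_iff)
  then show ?thesis
    by (simp only: sum_subtractf sum_distrib_left sum_divide_distrib add_diff_eq diff_add_eq)
qed

lemma orthogonal_bessel:
  assumes g: "\<And>j. g j \<in> L2 M" "\<And>i j. L2_inner M (g i) (g j) = (if i = j then of_real K else 0)"
    and K: "K > 0" and h: "h \<in> L2 M" and F: "finite F"
  shows "(\<Sum>j\<in>F. (cmod (L2_inner M h (g j)))\<^sup>2) \<le> K * (L2_norm M h)\<^sup>2"
proof -
  let ?c = "\<lambda>j. L2_inner M h (g j) / K"
  have "0 \<le> (L2_norm M (\<lambda>x. h x - (\<Sum>j\<in>F. ?c j * g j x)))\<^sup>2" by (rule zero_le_power2)
  also have "\<dots> = (L2_norm M h)\<^sup>2 - (\<Sum>j\<in>F. (cmod (L2_inner M h (g j)))\<^sup>2) / K"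
    by (subst orthogonal_expansion_error[where g = g, OF g K h F]) simp_all
  finally have "0 \<le> (L2_norm M h)\<^sup>2 - (\<Sum>j\<in>F. (cmod (L2_inner M h (g j)))\<^sup>2) / K" .
  then show ?thesis using K by (simp add: pos_divide_le_eq mult.commute[of K])
qed

text \<open>
  A tight frame on the closed span. The upper bound is Bessel's inequality. For the lower one,
  some finite combination approximates \<open>h\<close>, and by the identity above the best combination over
  the same index set does at least as well.
\<close>

lemma orthogonal_frame_seq:
  fixes g :: "'i::countable \<Rightarrow> 'a \<Rightarrow> complex"
  assumes g: "\<And>j. g j \<in> L2 M" "\<And>i j. L2_inner M (g i) (g j) = (if i = j then of_real K else 0)"
    and K: "K > 0"
  shows "frame_seq M g"
proof -
  have "(\<lambda>j. (cmod (L2_inner M h (g j)))\<^sup>2) summable_on UNIV \<and>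
        K * (L2_norm M h)\<^sup>2 \<le> (\<Sum>\<^sub>\<infinity>j. (cmod (L2_inner M h (g j)))\<^sup>2) \<and>
        (\<Sum>\<^sub>\<infinity>j. (cmod (L2_inner M h (g j)))\<^sup>2) \<le> K * (L2_norm M h)\<^sup>2"
    if hs: "h \<in> L2_closed_span M g" for h
  proof -
    have h: "h \<in> L2 M" using hs by (simp add: L2_closed_span_def)
    let ?S = "\<Sum>\<^sub>\<infinity>j. (cmod (L2_inner M h (g j)))\<^sup>2"
    have s: "(\<lambda>j. (cmod (L2_inner M h (g j)))\<^sup>2) summable_on UNIV"
      by (rule nonneg_bdd_above_summable_on)
         (auto intro!: bdd_aboveI[of _ "K * (L2_norm M h)\<^sup>2"] orthogonal_bessel g K h)
    have up: "?S \<le> K * (L2_norm M h)\<^sup>2"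
      by (intro infsum_le_finite_sums[OF s] orthogonal_bessel g K h)
    have "(L2_norm M h)\<^sup>2 \<le> ?S / K + e" if e: "e > 0" for e
    proof -
      obtain F c where F: "finite F" and
        lt: "L2_norm M (\<lambda>x. h x - (\<Sum>j\<in>F. c j * g j x)) < sqrt e"
        by (rule L2_closed_span_approx[OF hs g(1), of "sqrt e"]) (use e in auto)
      have "(L2_norm M (\<lambda>x. h x - (\<Sum>j\<in>F. c j * g j x)))\<^sup>2 < e"
        using power_strict_mono[OF lt L2_norm_nonneg, of 2] e by simp
      moreover have "(\<Sum>j\<in>F. (cmod (L2_inner M h (g j)))\<^sup>2) / K \<le> ?S / K"
        using K F s by (intro divide_right_mono finite_sum_le_infsum) auto
      moreover have "0 \<le> K * (\<Sum>j\<in>F. (cmod (c j - L2_inner M h (g j) / K))\<^sup>2)"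
        using K by (intro mult_nonneg_nonneg sum_nonneg) auto
      ultimately show ?thesis
        using orthogonal_expansion_error[where g = g, OF g K h F, of c] by linarith
    qed
    then have "(L2_norm M h)\<^sup>2 \<le> ?S / K" by (rule field_le_epsilon)
    then have "K * (L2_norm M h)\<^sup>2 \<le> ?S" using K by (simp add: pos_le_divide_eq mult.commute[of K])
    with s up show ?thesis by blast
  qed
  with g(1) K show ?thesis unfolding frame_seq_def by blast
qed

text \<open>
  Existence of orthogonal projections onto a finite-dimensional span, by Gram-Schmidt.
  The vectors may be linearly dependent: the residual \<open>w\<close> of the new
  vector may vanish almost everywhere, in which case orthogonality to it is automatic.
\<close>

lemma finite_span_projection:
  assumes "finite F" "\<And>j. j \<in> F \<Longrightarrow> v j \<in> L2 M" "u \<in> L2 M"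
  shows "\<exists>a. \<forall>i\<in>F. L2_inner M (\<lambda>x. u x - (\<Sum>j\<in>F. a j * v j x)) (v i) = 0"
  using assms
proof (induction F arbitrary: u rule: finite_induct)
  case (insert k F)
  have vF: "\<And>j. j \<in> F \<Longrightarrow> v j \<in> L2 M" and vk: "v k \<in> L2 M" using insert.prems by auto
  obtain a where a: "\<And>i. i \<in> F \<Longrightarrow> L2_inner M (\<lambda>x. u x - (\<Sum>j\<in>F. a j * v j x)) (v i) = 0"
    using insert.IH[where u = u] vF insert.prems by blast
  obtain b where b: "\<And>i. i \<in> F \<Longrightarrow> L2_inner M (\<lambda>x. v k x - (\<Sum>j\<in>F. b j * v j x)) (v i) = 0"
    using insert.IH[where u = "v k"] vk vF by blast
  define r where "r = (\<lambda>x. u x - (\<Sum>j\<in>F. a j * v j x))"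
  define w where "w = (\<lambda>x. v k x - (\<Sum>j\<in>F. b j * v j x))"
  have L: "r \<in> L2 M" "w \<in> L2 M" 
    unfolding r_def w_def using insert.prems by (auto intro!: L2_diff L2_lincomb)
  have inner_vk: "L2_inner M s (v k) = L2_inner M s w"
    if "s \<in> L2 M" "\<And>i. i \<in> F \<Longrightarrow> L2_inner M s (v i) = 0" for s
    unfolding w_def using that vF vk
    by (subst L2_inner_diff_right) (auto intro!: L2_lincomb simp: L2_inner_lincomb_right)
  define t where "t = L2_inner M r w / L2_inner M w w"
  define s where "s = (\<lambda>x. r x - t * w x)"
  have s: "s \<in> L2 M" unfolding s_def by (intro L2_diff L2_scale L)
  have si: "L2_inner M s (v i) = 0" if "i \<in> F" for i
    using a[OF that] b[OF that] vF[OF that] L unfolding s_def r_def[symmetric] w_def[symmetric]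
    by (simp add: L2_inner_diff_left L2_scale L2_inner_scale_left)
  have "L2_inner M s w = 0"
  proof (cases "L2_inner M w w = 0")
    case True
    then have "AE x in M. w x = 0"
      using L by (intro L2_norm_zero_imp_AE_zero) (auto simp: L2_inner_self)
    then show ?thesis
      by (intro L2_inner_eq_0_AE s L) auto
  next
    case False
    have "L2_inner M s w = L2_inner M r w - t * L2_inner M w w"
      unfolding s_def by (simp add: L2_inner_diff_left L2_scale L2_inner_scale_left L)
    with False show ?thesis by (simp add: t_def)
  qed
  then have sk: "L2_inner M s (v k) = 0" using inner_vk[OF s si] by simp
  have "s = (\<lambda>x. u x - (\<Sum>j\<in>insert k F. (if j = k then t else a j - t * b j) * v j x))"
  proof
    fix x
    have "(\<Sum>j\<in>F. (if j = k then t else a j - t * b j) * v j x)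
        = (\<Sum>j\<in>F. a j * v j x - t * (b j * v j x))"
      using insert.hyps by (intro sum.cong refl) (auto simp: algebra_simps)
    then show "s x = u x - (\<Sum>j\<in>insert k F. (if j = k then t else a j - t * b j) * v j x)"
      using insert.hyps
      by (simp add: s_def r_def w_def sum_subtractf sum_distrib_left[symmetric] algebra_simps)
  qed
  then show ?case
    using si sk by (intro exI[of _ "\<lambda>j. if j = k then t else a j - t * b j"]) auto
qed simp


section \<open>Generalized duals and biorthogonality\<close>

text \<open>
  The expansion of \<open>f i\<close> competes with the trivial expansion of \<open>f i\<close> by itself. Their
  difference tends to zero, and by the lower Riesz bound its norm controls every single
  coefficient of the difference.
\<close>

lemma generalized_dual_imp_biorthogonal:
  assumes "generalized_dual M f g"
  shows "L2_inner M (f i) (g j) = (if i = j then 1 else 0)"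
proof -
  let ?a = "\<lambda>j. L2_inner M (f i) (g j)" and ?d = "\<lambda>j. if i = j then 1 else 0 :: complex"
  let ?N = "\<lambda>F. L2_norm M (\<lambda>x. f i x - (\<Sum>j\<in>F. ?a j * f j x))"
  from assms obtain A0 where f: "\<And>j. f j \<in> L2 M" and A0: "A0 > 0" and
    lower: "\<And>F c. finite F \<Longrightarrow>
      A0 * (\<Sum>j\<in>F. (cmod (c j))\<^sup>2) \<le> (L2_norm M (\<lambda>x. \<Sum>j\<in>F. c j * f j x))\<^sup>2"
    unfolding generalized_dual_def riesz_seq_def by blast
  have lim: "(?N \<longlongrightarrow> 0) (finite_subsets_at_top UNIV)"
    using assms generator_in_L2_closed_span[of f i M, OF f] by (simp add: generalized_dual_def)
  have ev: "\<forall>\<^sub>F F in finite_subsets_at_top UNIV. A0 * (cmod (?d j - ?a j))\<^sup>2 \<le> (?N F)\<^sup>2"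
    unfolding eventually_finite_subsets_at_top
  proof (intro exI[of _ "{i, j}"] conjI allI impI)
    fix F :: "'b set" assume F: "finite F \<and> {i, j} \<subseteq> F \<and> F \<subseteq> UNIV"
    have eq: "(\<lambda>x. \<Sum>j\<in>F. (?d j - ?a j) * f j x) = (\<lambda>x. f i x - (\<Sum>j\<in>F. ?a j * f j x))"
      using F by (auto simp: left_diff_distrib sum_subtractf if_distrib[of "\<lambda>c. c * _"] cong: if_cong)
    have "(cmod (?d j - ?a j))\<^sup>2 \<le> (\<Sum>j\<in>F. (cmod (?d j - ?a j))\<^sup>2)"
      using F by (intro member_le_sum[where f = "\<lambda>j. (cmod (?d j - ?a j))\<^sup>2"]) auto
    then have "A0 * (cmod (?d j - ?a j))\<^sup>2 \<le> A0 * (\<Sum>j\<in>F. (cmod (?d j - ?a j))\<^sup>2)"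
      using A0 by simp
    also have "\<dots> \<le> (?N F)\<^sup>2"
      using lower[of F "\<lambda>j. ?d j - ?a j"] F unfolding eq by simp
    finally show "A0 * (cmod (?d j - ?a j))\<^sup>2 \<le> (?N F)\<^sup>2" .
  qed auto
  have "A0 * (cmod (?d j - ?a j))\<^sup>2 \<le> 0"
    by (rule tendsto_lowerbound[OF _ ev]) (use tendsto_power[OF lim, of 2] in auto)
  then have "cmod (?d j - ?a j) = 0"
    using A0 by (simp add: mult_le_0_iff)
  then show ?thesis by simp
qed

text \<open>
  The expansion reproduces finite combinations of \<open>f\<close> exactly, by biorthogonality. The operators
  taking \<open>h\<close> to its partial expansions are uniformly bounded, by Bessel's inequality for \<open>g\<close> and
  the upper Riesz bound for \<open>f\<close>. Hence convergence extends from the span to its closure.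
\<close>

lemma biorthogonal_bessel_imp_generalized_dual:
  fixes f :: "'i::countable \<Rightarrow> 'a \<Rightarrow> complex"
  assumes riesz: "riesz_seq M f" and g: "\<And>j. g j \<in> L2 M"
    and bi: "\<And>i j. L2_inner M (f i) (g j) = (if i = j then 1 else 0)"
    and bessel: "\<And>h F. h \<in> L2 M \<Longrightarrow> finite F \<Longrightarrow>
      (\<Sum>j\<in>F. (cmod (L2_inner M h (g j)))\<^sup>2) \<le> K * (L2_norm M h)\<^sup>2"
    and K: "K > 0"
  shows "generalized_dual M f g"
proof -
  from riesz obtain B0 where f: "\<And>j. f j \<in> L2 M" and B0: "B0 > 0" and
    upper: "\<And>F c. finite F \<Longrightarrow>
      (L2_norm M (\<lambda>x. \<Sum>j\<in>F. c j * f j x))\<^sup>2 \<le> B0 * (\<Sum>j\<in>F. (cmod (c j))\<^sup>2)"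
    unfolding riesz_seq_def by blast
  have "((\<lambda>F. L2_norm M (\<lambda>x. h x - (\<Sum>j\<in>F. L2_inner M h (g j) * f j x))) \<longlongrightarrow> 0)
          (finite_subsets_at_top UNIV)" (is "(?N \<longlongrightarrow> 0) _")
    if hs: "h \<in> L2_closed_span M f" for h
  proof (rule tendstoI)
    fix e :: real assume e: "e > 0"
    have h: "h \<in> L2 M" using hs by (simp add: L2_closed_span_def)
    \<comment> \<open>If \<open>q\<close> is the difference of \<open>h\<close> and a finite combination, the squared error of the expansion is
      at most \<open>D\<close> times the squared norm of \<open>q\<close>. Norms of \<open>q\<close> below \<open>e / (D + 1)\<close> suffice since
      \<open>D < (D + 1)\<^sup>2\<close>.\<close>
    define D where "D = 2 + 2 * (B0 * K)"
    have D: "D > 0" using B0 K by (simp add: D_def add_pos_pos)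
    obtain G c where G: "finite G" and
      lt: "L2_norm M (\<lambda>x. h x - (\<Sum>j\<in>G. c j * f j x)) < e / (D + 1)"
      by (rule L2_closed_span_approx[OF hs f, of "e / (D + 1)"]) (use e D in auto)
    define q where "q = (\<lambda>x. h x - (\<Sum>j\<in>G. c j * f j x))"
    have q: "q \<in> L2 M" unfolding q_def by (intro L2_diff L2_lincomb f h)
    have qg: "L2_inner M q (g j) = L2_inner M h (g j) - (if j \<in> G then c j else 0)" for j
      unfolding q_def using G
      by (simp add: L2_inner_diff_left L2_lincomb f g h L2_inner_lincomb_left bi if_distrib
          cong: if_cong)
    have bound: "?N F < e" if F: "finite F" "G \<subseteq> F" for F
    proof -
      have "(\<Sum>j\<in>F. L2_inner M q (g j) * f j x)
          = (\<Sum>j\<in>F. L2_inner M h (g j) * f j x) - (\<Sum>j\<in>G. c j * f j x)" for x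
      proof -
        have "(\<Sum>j\<in>F. (if j \<in> G then c j else 0) * f j x) = (\<Sum>j\<in>G. c j * f j x)"
          using F by (intro sum.mono_neutral_cong_right) auto
        then show ?thesis by (simp add: qg left_diff_distrib sum_subtractf)
      qed
      then have eq: "(\<lambda>x. h x - (\<Sum>j\<in>F. L2_inner M h (g j) * f j x))
          = (\<lambda>x. q x + (\<Sum>j\<in>F. (- L2_inner M q (g j)) * f j x))"
        by (auto simp: q_def sum_negf)
      have "(?N F)\<^sup>2 \<le> 2 * (L2_norm M q)\<^sup>2
          + 2 * (L2_norm M (\<lambda>x. \<Sum>j\<in>F. (- L2_inner M q (g j)) * f j x))\<^sup>2"
        unfolding eq by (intro L2_norm_square_add_le q L2_lincomb f)
      also have "(L2_norm M (\<lambda>x. \<Sum>j\<in>F. (- L2_inner M q (g j)) * f j x))\<^sup>2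
          \<le> B0 * (\<Sum>j\<in>F. (cmod (- L2_inner M q (g j)))\<^sup>2)"
        by (rule upper[OF F(1)])
      also have "\<dots> \<le> B0 * (K * (L2_norm M q)\<^sup>2)"
        using bessel[OF q F(1)] B0 by simp
      finally have "(?N F)\<^sup>2 \<le> D * (L2_norm M q)\<^sup>2" by (simp add: D_def algebra_simps)
      also have "\<dots> \<le> D * (e / (D + 1))\<^sup>2"
        using lt D L2_norm_nonneg[of M q] by (intro mult_left_mono power_mono) (auto simp: q_def)
      also have "\<dots> = e\<^sup>2 * (D / (D + 1)\<^sup>2)" by (simp add: power_divide)
      also have "\<dots> < e\<^sup>2 * 1"
      proof (intro mult_strict_left_mono)
        have "D < (D + 1)\<^sup>2" using D by (simp add: power2_eq_square algebra_simps add_pos_pos)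
        then show "D / (D + 1)\<^sup>2 < 1" using D by simp
      qed (use e in auto)
      finally show ?thesis using e by (simp add: power_less_imp_less_base)
    qed
    show "\<forall>\<^sub>F F in finite_subsets_at_top UNIV. dist (?N F) 0 < e"
      unfolding eventually_finite_subsets_at_top
      using G bound by (intro exI[of _ G]) (auto simp: L2_norm_nonneg)
  qed
  with riesz g show ?thesis by (simp add: generalized_dual_def)
qed


section \<open>Left translations preserve Lebesgue measure\<close>

lemma heis_mult_measurable [measurable]: "heis_mult u \<in> borel_measurable borel"
  unfolding heis_mult_def case_prod_beta
  by (intro borel_measurable_continuous_onI continuous_intros)

lemma nn_integral_lborel_triple:
  fixes f :: "heis \<Rightarrow> ennreal"
  assumes [measurable]: "f \<in> borel_measurable borel"
  shows "(\<integral>\<^sup>+p. f p \<partial>lborel) = (\<integral>\<^sup>+x. \<integral>\<^sup>+y. \<integral>\<^sup>+t. f (x, y, t) \<partial>lborel \<partial>lborel \<partial>lborel)"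
proof -
  have "(\<integral>\<^sup>+p. f p \<partial>lborel) = (\<integral>\<^sup>+p. f p \<partial>((lborel::real measure) \<Otimes>\<^sub>M (lborel::(real\<times>real) measure)))"
    by (simp add: lborel_prod)
  also have "\<dots> = (\<integral>\<^sup>+x. \<integral>\<^sup>+q. f (x, q) \<partial>lborel \<partial>lborel)"
    by (subst lborel.nn_integral_fst[symmetric]) (auto simp: lborel_prod)
  also have "\<dots> = (\<integral>\<^sup>+x. \<integral>\<^sup>+q. f (x, q) \<partial>((lborel::real measure) \<Otimes>\<^sub>M (lborel::real measure)) \<partial>lborel)"
    by (simp add: lborel_prod)
  also have "\<dots> = (\<integral>\<^sup>+x. \<integral>\<^sup>+y. \<integral>\<^sup>+t. f (x, y, t) \<partial>lborel \<partial>lborel \<partial>lborel)"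
    by (subst lborel.nn_integral_fst[symmetric]) (auto simp: lborel_prod)
  finally show ?thesis .
qed

lemma nn_integral_lborel_translate:
  fixes f :: "real \<Rightarrow> ennreal"
  assumes [measurable]: "f \<in> borel_measurable borel"
  shows "(\<integral>\<^sup>+x. f (a + x) \<partial>lborel) = (\<integral>\<^sup>+x. f x \<partial>lborel)"
  using nn_integral_real_affine[of f 1 a] by simp

text \<open>
  A left translation is a shear followed by a Euclidean translation. When the integral is iterated
  with \<open>t\<close> innermost, the shear shifts \<open>t\<close> by an amount that is constant for fixed \<open>x\<close> and \<open>y\<close>,
  so each variable is merely translated.
\<close>

lemma nn_integral_heis_mult:
  fixes f :: "heis \<Rightarrow> ennreal"
  assumes [measurable]: "f \<in> borel_measurable borel"
  shows "(\<integral>\<^sup>+p. f (heis_mult u p) \<partial>lborel) = (\<integral>\<^sup>+p. f p \<partial>lborel)"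
proof -
  obtain a b c where u: "u = (a, b, c)" by (cases u)
  have "(\<integral>\<^sup>+p. f (heis_mult u p) \<partial>lborel)
      = (\<integral>\<^sup>+x. \<integral>\<^sup>+y. \<integral>\<^sup>+t. f (a + x, b + y, (c + 1/2 * (x * b - y * a)) + t) \<partial>lborel \<partial>lborel \<partial>lborel)"
    by (subst nn_integral_lborel_triple) (measurable, simp add: u heis_mult_def algebra_simps)
  also have "\<dots> = (\<integral>\<^sup>+x. \<integral>\<^sup>+y. \<integral>\<^sup>+t. f (a + x, b + y, t) \<partial>lborel \<partial>lborel \<partial>lborel)"
    by (intro nn_integral_cong nn_integral_lborel_translate) measurable
  also have "\<dots> = (\<integral>\<^sup>+x. \<integral>\<^sup>+y. \<integral>\<^sup>+t. f (a + x, y, t) \<partial>lborel \<partial>lborel \<partial>lborel)"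
    by (intro nn_integral_cong nn_integral_lborel_translate[where f = "\<lambda>y. \<integral>\<^sup>+t. f (_, y, t) \<partial>lborel"])
       measurable
  also have "\<dots> = (\<integral>\<^sup>+x. \<integral>\<^sup>+y. \<integral>\<^sup>+t. f (x, y, t) \<partial>lborel \<partial>lborel \<partial>lborel)"
    by (intro nn_integral_lborel_translate[where f = "\<lambda>x. \<integral>\<^sup>+y. \<integral>\<^sup>+t. f (x, y, t) \<partial>lborel \<partial>lborel"])
       measurable
  finally show ?thesis by (simp add: nn_integral_lborel_triple)
qed

lemma distr_heis_mult: "distr lborel borel (heis_mult u) = lborel"
proof (rule measure_eqI)
  fix S assume "S \<in> sets (distr lborel borel (heis_mult u))"
  then have [measurable]: "S \<in> sets borel" by simp
  have "emeasure (distr lborel borel (heis_mult u)) S = (\<integral>\<^sup>+p. indicator S p \<partial>distr lborel borel (heis_mult u))"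
    by simp
  also have "\<dots> = (\<integral>\<^sup>+p. indicator S (heis_mult u p) \<partial>lborel)"
    by (subst nn_integral_distr) auto
  also have "\<dots> = emeasure lborel S" by (subst nn_integral_heis_mult) auto
  finally show "emeasure (distr lborel borel (heis_mult u)) S = emeasure lborel S" .
qed simp

lemma AE_heis_mult:
  assumes "AE p in lborel. P p"
  shows "AE p in lborel. P (heis_mult u p)"
proof (rule AE_distrD[of "heis_mult u" lborel borel])
  show "AE p in distr lborel borel (heis_mult u). P p"
    unfolding distr_heis_mult by (rule assms)
qed simp

lemma left_transl_L2:
  assumes "f \<in> L2 lborel"
  shows "left_transl u f \<in> L2 lborel"
proof -
  have [measurable]: "f \<in> borel_measurable borel" using L2_measurable[OF assms] by simp
  have "integrable (distr lborel borel (heis_mult (heis_inv u))) (\<lambda>p. (cmod (f p))\<^sup>2)"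
    using L2_integrable[OF assms] by (simp add: distr_heis_mult)
  then have "integrable lborel (\<lambda>p. (cmod (left_transl u f p))\<^sup>2)"
    by (subst (asm) integrable_distr_eq) (auto simp: left_transl_def)
  then show ?thesis by (simp add: L2_def left_transl_def[abs_def])
qed

lemma lattice_transl_L2: "f \<in> L2 lborel \<Longrightarrow> lattice_transl f j \<in> L2 lborel"
  by (auto simp: lattice_transl_def left_transl_L2 split: prod.splits)

lemma left_transl_inner:
  assumes "f \<in> L2 lborel" "g \<in> L2 lborel"
  shows "L2_inner lborel (left_transl u f) (left_transl u g) = L2_inner lborel f g"
proof -
  have [measurable]: "f \<in> borel_measurable borel" "g \<in> borel_measurable borel"
    using assms[THEN L2_measurable] by simp_all
  have "L2_inner lborel f g
      = (LINT p|distr lborel borel (heis_mult (heis_inv u)). f p * cnj (g p))"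
    by (simp add: distr_heis_mult L2_inner_def)
  also have "\<dots> = L2_inner lborel (left_transl u f) (left_transl u g)"
    by (subst integral_distr) (auto simp: left_transl_def L2_inner_def)
  finally show ?thesis by simp
qed


section \<open>The lattice and the cell\<close>

text \<open>
  The index of the group element \<open>u\<^sub>j\<close>-inverse times \<open>u\<^sub>i\<close>, where \<open>u\<^sub>j\<close> is the lattice point
  \<open>(2k, l, m)\<close> for \<open>j = (k, l, m)\<close>. Its entries are integers because the factor \<open>2\<close>
  cancels the \<open>1/2\<close> of the group law.
\<close>

definition lattice_quotient :: "int \<times> int \<times> int \<Rightarrow> int \<times> int \<times> int \<Rightarrow> int \<times> int \<times> int" where
  "lattice_quotient = (\<lambda>(k, l, m) (k', l', m'). (k' - k, l' - l, m' - m - k' * l + l' * k))"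

lemma lattice_quotient_eq_0_iff: "lattice_quotient j i = (0, 0, 0) \<longleftrightarrow> i = j"
  by (auto simp: lattice_quotient_def split: prod.splits)

lemma lattice_transl_0: "lattice_transl f (0, 0, 0) = f"
  by (auto simp: lattice_transl_def left_transl_def heis_inv_def heis_group_laws)

text \<open>
  Translation invariance reduces all inner products between two lattice systems to inner products
  with the generator of one of them.
\<close>

lemma lattice_transl_inner:
  assumes "f \<in> L2 lborel" "g \<in> L2 lborel"
  shows "L2_inner lborel (lattice_transl f i) (lattice_transl g j)
    = L2_inner lborel (lattice_transl f (lattice_quotient j i)) g"
proof -
  obtain k l m where j: "j = (k, l, m)" by (cases j)
  let ?u = "(2 * of_int k, of_int l, of_int m)"
  have "lattice_transl f i = left_transl ?u (lattice_transl f (lattice_quotient j i))"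
    by (cases i) (auto simp: lattice_transl_def left_transl_def lattice_quotient_def j heis_mult_def
        heis_inv_def algebra_simps add_divide_distrib diff_divide_distrib split: prod.splits)
  moreover have "lattice_transl g j = left_transl ?u g"
    by (simp add: lattice_transl_def j)
  ultimately show ?thesis
    using assms by (simp add: left_transl_inner lattice_transl_L2)
qed

lemma lborel_Times_null:
  fixes A :: "'a::euclidean_space set" and B :: "'b::euclidean_space set"
  assumes "A \<in> sets borel" "B \<in> sets borel" "emeasure lborel A = 0 \<or> emeasure lborel B = 0"
  shows "A \<times> B \<in> null_sets lborel"
proof -
  have "emeasure (lborel \<Otimes>\<^sub>M lborel) (A \<times> B) = emeasure lborel A * emeasure lborel B"
    using assms by (intro lborel.emeasure_pair_measure_Times) auto
  then show ?thesis
    using assms by (auto simp: lborel_prod null_sets_def borel_Times)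
qed

text \<open>
  Almost every point has no integer coordinate. At such points membership in a box with integer
  corners gives strict inequalities, which is what makes the index bounds below sharp.
\<close>

definition off_integers :: "heis \<Rightarrow> bool" where
  "off_integers = (\<lambda>(x, y, t). x \<notin> \<int> \<and> y \<notin> \<int> \<and> t \<notin> \<int>)"

lemma AE_off_integers: "AE p in lborel. off_integers p"
proof -
  have Z: "(\<int> :: real set) \<in> sets borel" "emeasure lborel (\<int> :: real set) = 0"
    using countable_imp_null_set_lborel[OF countable_int] by (auto simp: null_sets_def)
  have "\<int> \<times> UNIV \<union> (UNIV \<times> (\<int> \<times> UNIV) \<union> UNIV \<times> (UNIV \<times> \<int>)) \<in> null_sets (lborel :: heis measure)"
    using Z lborel_Times_null[of "\<int> :: real set" "UNIV :: real set"]
      lborel_Times_null[of "UNIV :: real set" "\<int> :: real set"]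
    by (intro null_sets.Un lborel_Times_null) (auto simp: borel_Times)
  then show ?thesis
    by (rule AE_I') (auto simp: off_integers_def)
qed

lemma between_integers_strict:
  fixes x :: real
  assumes "x \<in> {of_int a..of_int b}" "x \<notin> \<int>"
  shows "of_int a < x" "x < of_int b"
  using assms Ints_of_int[of a, where 'a = real] Ints_of_int[of b, where 'a = real]
  by (auto simp: less_le)

lemma Q_cell_off_integers:
  assumes "(x, y, t) \<in> Q_cell" "off_integers (x, y, t)"
  shows "0 < x" "x < 2" "0 < y" "y < 1" "0 < t" "t < 1"
  using assms between_integers_strict[of x 0 2] between_integers_strict[of y 0 1]
    between_integers_strict[of t 0 1]
  by (auto simp: Q_cell_def off_integers_def)

lemma box_off_integers:
  assumes "(x, y, t) \<in> {0..2 * real n} \<times> {0..real n} \<times> {0..real M}" "off_integers (x, y, t)"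
  shows "0 < x" "x < 2 * real n" "0 < y" "y < real n" "0 < t" "t < real M"
  using assms between_integers_strict[of x 0 "2 * int n"] between_integers_strict[of y 0 "int n"]
    between_integers_strict[of t 0 "int M"]
  by (auto simp: off_integers_def)

text \<open>
  If the translate by \<open>(2k, l, m)\<close> does not vanish at a point \<open>(x, y, t)\<close> of the cell, then
  \<open>(x - 2k, y - l, t - m + k y - l x / 2)\<close> lies in the box that supports \<open>\<phi>\<close>. The first two
  coordinates bound \<open>k\<close> and \<open>l\<close>; then \<open>- l x / 2\<close> lies between \<open>0\<close> and \<open>n - 1\<close>, and \<open>k y\<close> between
  \<open>1 - n\<close> and \<open>0\<close>, which bounds \<open>m\<close>.
\<close>

lemma lattice_transl_zero_on_Q_cell:
  assumes supp: "supported_in \<phi> ({0..2 * real n} \<times> {0..real n} \<times> {0..real M})"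
    and j: "j \<notin> A_index M n"
  shows "AE p in lborel. p \<in> Q_cell \<longrightarrow> lattice_transl \<phi> j p = 0"
proof -
  obtain k l m where klm: "j = (k, l, m)" by (cases j)
  let ?T = "heis_mult (heis_inv (2 * of_int k, of_int l, of_int m))"
  have in_A: "j \<in> A_index M n" if
    p: "(x, y, t) \<in> Q_cell" "off_integers (x, y, t)" and
    q: "?T (x, y, t) \<in> {0..2 * real n} \<times> {0..real n} \<times> {0..real M}" "off_integers (?T (x, y, t))"
    for x y t
  proof -
    define s where "s = t - m + (k * y - l * x / 2)"
    have T: "?T (x, y, t) = (x - 2 * k, y - l, s)"
      by (simp add: heis_mult_def heis_inv_def s_def field_simps)
    note P = Q_cell_off_integers[OF p] and R = box_off_integers[OF q[unfolded T]]
    have k: "k \<le> 0" "- int n < k" using P R by linarith+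
    have l: "l \<le> 0" "- int n < l" using P R by linarith+
    have "real_of_int l * 2 \<le> l * x" "real_of_int l * x \<le> 0"
      using P l by (auto intro: mult_left_mono_neg mult_nonpos_nonneg)
    moreover have "real_of_int k \<le> k * y" "real_of_int k * y \<le> 0"
      using P k mult_left_mono_neg[of y 1 "real_of_int k"] by (auto intro: mult_nonpos_nonneg)
    ultimately have "real_of_int m < 1 - l" "real_of_int k - M < m"
      using P R unfolding s_def by linarith+
    then have "m < int n" "- int M - int n + 1 < m" using k l by linarith+
    with k l show ?thesis by (simp add: A_index_def klm)
  qed
  have "AE p in lborel. off_integers (?T p)"
    by (rule AE_heis_mult[OF AE_off_integers])
  moreover have "AE p in lborel.
      ?T p \<notin> {0..2 * real n} \<times> {0..real n} \<times> {0..real M} \<longrightarrow> \<phi> (?T p) = 0"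
    by (rule AE_heis_mult[OF supp[unfolded supported_in_def]])
  ultimately show ?thesis
    using AE_off_integers
  proof eventually_elim
    case (elim p)
    show ?case
    proof (cases p)
      case (fields x y t)
      then show ?thesis
        using in_A[of x y t] j elim by (auto simp: lattice_transl_def left_transl_def klm)
    qed
  qed
qed

text \<open>
  The cell tiles: its interior is disjoint from its nontrivial lattice translates. The first two
  coordinates force \<open>k = l = 0\<close>, after which the shear is trivial and \<open>m = 0\<close> follows.
\<close>

lemma lattice_transl_disjoint_cells:
  assumes supp: "supported_in \<psi> Q_cell" and j: "j \<noteq> (0, 0, 0)"
  shows "AE p in lborel. lattice_transl \<psi> j p * cnj (\<psi> p) = 0"
proof -
  obtain k l m where klm: "j = (k, l, m)" by (cases j)
  let ?T = "heis_mult (heis_inv (2 * of_int k, of_int l, of_int m))"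
  have not_both: False if
    p: "(x, y, t) \<in> Q_cell" "off_integers (x, y, t)" and
    q: "?T (x, y, t) \<in> Q_cell" "off_integers (?T (x, y, t))" for x y t
  proof -
    define s where "s = t - m + (k * y - l * x / 2)"
    have T: "?T (x, y, t) = (x - 2 * k, y - l, s)"
      by (simp add: heis_mult_def heis_inv_def s_def field_simps)
    note P = Q_cell_off_integers[OF p] and R = Q_cell_off_integers[OF q[unfolded T]]
    have "k = 0" "l = 0" using P R by linarith+
    then have "s = t - m" by (simp add: s_def)
    then have "m = 0" using P R by linarith
    with \<open>k = 0\<close> \<open>l = 0\<close> show False using j klm by simp
  qed
  have "AE p in lborel. off_integers (?T p)"
    by (rule AE_heis_mult[OF AE_off_integers])
  moreover have "AE p in lborel. ?T p \<notin> Q_cell \<longrightarrow> \<psi> (?T p) = 0"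
    by (rule AE_heis_mult[OF supp[unfolded supported_in_def]])
  moreover note supp[unfolded supported_in_def]
  ultimately show ?thesis
    using AE_off_integers
  proof eventually_elim
    case (elim p)
    show ?case
    proof (cases p)
      case (fields x y t)
      then show ?thesis
        using not_both[of x y t] elim by (auto simp: lattice_transl_def left_transl_def klm)
    qed
  qed
qed

lemma lattice_system_in_cell_orthogonal:
  assumes "\<psi> \<in> L2 lborel" "supported_in \<psi> Q_cell"
  shows "L2_inner lborel (lattice_transl \<psi> i) (lattice_transl \<psi> j)
    = (if i = j then of_real ((L2_norm lborel \<psi>)\<^sup>2) else 0)"
proof (cases "i = j")
  case True
  then have "lattice_quotient j i = (0, 0, 0)" by (simp add: lattice_quotient_eq_0_iff)
  then have "L2_inner lborel (lattice_transl \<psi> i) (lattice_transl \<psi> j) = L2_inner lborel \<psi> \<psi>"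
    by (simp only: lattice_transl_inner[OF assms(1) assms(1), of i j] lattice_transl_0)
  with True show ?thesis by (simp only: L2_inner_self simp_thms if_True)
next
  case False
  then have "lattice_quotient j i \<noteq> (0, 0, 0)" by (simp add: lattice_quotient_eq_0_iff)
  then have "L2_inner lborel (lattice_transl \<psi> (lattice_quotient j i)) \<psi> = 0"
    using assms by (intro L2_inner_eq_0_AE lattice_transl_disjoint_cells lattice_transl_L2)
  with False show ?thesis by (simp add: lattice_transl_inner assms(1))
qed

text \<open>
  If \<open>n\<close> or \<open>M\<close> were zero, the supporting box would be a null set and \<open>\<phi>\<close> would vanish almost
  everywhere, against the lower Riesz bound. Consequently the origin belongs to \<open>A\<close>.
\<close>

lemma riesz_generator_support_nondegenerate:
  assumes L2: "\<phi> \<in> L2 lborel"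
    and supp: "supported_in \<phi> ({0..2 * real n} \<times> {0..real n} \<times> {0..real M})"
    and riesz: "riesz_seq lborel (lattice_transl \<phi>)"
  shows "n \<ge> 1 \<and> M \<ge> 1"
proof (rule ccontr)
  assume deg: "\<not> (n \<ge> 1 \<and> M \<ge> 1)"
  have "AE p in lborel. \<phi> p = 0"
    using AE_off_integers supp[unfolded supported_in_def]
  proof eventually_elim
    case (elim p)
    show ?case
    proof (cases p)
      case (fields x y t)
      then show ?thesis using elim deg box_off_integers[of x y t n M] by fastforce
    qed
  qed
  then have "L2_norm lborel \<phi> = 0"
    using L2_norm_cong_AE[OF L2 L2_zero] by (simp add: L2_norm_def)
  moreover from riesz obtain A0 where A0: "A0 > 0" and
    lower: "\<And>F c. finite F \<Longrightarrow> A0 * (\<Sum>j\<in>F. (cmod (c j))\<^sup>2)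
      \<le> (L2_norm lborel (\<lambda>x. \<Sum>j\<in>F. c j * lattice_transl \<phi> j x))\<^sup>2"
    unfolding riesz_seq_def by blast
  have "A0 \<le> (L2_norm lborel \<phi>)\<^sup>2"
    using lower[of "{(0, 0, 0)}" "\<lambda>_. 1"] by (simp add: lattice_transl_0)
  ultimately show False using A0 by simp
qed

lemma finite_A_index: "finite (A_index M n)"
  by (rule finite_subset[of _ "{- (int n - 1)..0} \<times> {- (int n - 1)..0} \<times> {- int M - int n + 1<..<int n}"])
     (auto simp: A_index_def)

lemma sets_Q_cell: "Q_cell \<in> sets borel"
  unfolding Q_cell_def by (intro borel_Times) auto


section \<open>Duals supported in the cell\<close>

text \<open>
  Removes the two existential layers of the span of restrictions: coefficients extend by zero to
  the whole finite index set, and square-integrability on \<open>S\<close> is inherited from the whole space.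
\<close>

lemma L2_span_restrict_space_iff:
  fixes f :: "'i \<Rightarrow> 'a \<Rightarrow> complex"
  assumes g: "g \<in> L2 M" and S: "S \<in> sets M" and I: "finite I"
  shows "g \<in> L2_span (restrict_space M S) f I
    \<longleftrightarrow> (\<exists>c. AE x in M. x \<in> S \<longrightarrow> g x = (\<Sum>j\<in>I. c j * f j x))"
proof -
  have int: "S \<inter> space M \<in> sets M" using S by auto
  have "integrable M (\<lambda>x. indicator S x *\<^sub>R (cmod (g x))\<^sup>2)"
    using integrable_mult_indicator[OF S L2_integrable[OF g]] by simp
  then have gS: "g \<in> L2 (restrict_space M S)"
    using L2_measurable[OF g] int
    by (auto simp: L2_def measurable_restrict_space1 integrable_restrict_space set_integrable_def)
  show ?thesis
  proof
    assume "g \<in> L2_span (restrict_space M S) f I"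
    then obtain F c where F: "finite F" "F \<subseteq> I"
      and ae: "AE x in M. x \<in> S \<longrightarrow> g x = (\<Sum>j\<in>F. c j * f j x)"
      using int by (auto simp: L2_span_def AE_restrict_space_iff)
    have "(\<Sum>j\<in>F. c j * f j x) = (\<Sum>j\<in>I. (if j \<in> F then c j else 0) * f j x)" for x
      using F I by (intro sum.mono_neutral_cong_left) auto
    with ae show "\<exists>c. AE x in M. x \<in> S \<longrightarrow> g x = (\<Sum>j\<in>I. c j * f j x)"
      by (intro exI[of _ "\<lambda>j. if j \<in> F then c j else 0"]) simp
  next
    assume "\<exists>c. AE x in M. x \<in> S \<longrightarrow> g x = (\<Sum>j\<in>I. c j * f j x)"
    then show "g \<in> L2_span (restrict_space M S) f I"
      using gS I int by (auto simp: L2_span_def AE_restrict_space_iff)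
  qed
qed

text \<open>
  By translation invariance, conditions on inner products with the single function \<open>\<psi>\<close> amount to
  biorthogonality of the two systems, and the tiling supplies orthogonality and hence Bessel's
  inequality. The frame bound is the squared norm of \<open>\<psi>\<close>, which is positive because \<open>\<langle>\<phi>, \<psi>\<rangle> = 1\<close>.
\<close>

lemma cell_dual_properties:
  assumes \<phi>: "\<phi> \<in> L2 lborel" "riesz_seq lborel (lattice_transl \<phi>)"
    and \<psi>: "\<psi> \<in> L2 lborel" "supported_in \<psi> Q_cell"
    and bi: "\<And>j. L2_inner lborel (lattice_transl \<phi> j) \<psi> = (if j = (0, 0, 0) then 1 else 0)"
  shows "orthogonal_seq lborel (lattice_transl \<psi>)"
    and "oblique_dual lborel (lattice_transl \<phi>) (lattice_transl \<psi>)"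
proof -
  let ?K = "(L2_norm lborel \<psi>)\<^sup>2"
  note orth = lattice_system_in_cell_orthogonal[OF \<psi>] and mem = lattice_transl_L2[OF \<psi>(1)]
  have "L2_norm lborel \<psi> \<noteq> 0"
  proof
    assume "L2_norm lborel \<psi> = 0"
    then have "AE p in lborel. \<psi> p = 0" by (rule L2_norm_zero_imp_AE_zero[OF \<psi>(1)])
    then have "L2_inner lborel \<phi> \<psi> = 0"
      by (intro L2_inner_eq_0_AE[OF \<phi>(1) \<psi>(1)]) auto
    then show False using bi[of "(0, 0, 0)"] by (simp add: lattice_transl_0)
  qed
  then have K: "?K > 0" by simp
  show "orthogonal_seq lborel (lattice_transl \<psi>)"
    by (simp add: orthogonal_seq_def orth)
  have "generalized_dual lborel (lattice_transl \<phi>) (lattice_transl \<psi>)"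
  proof (rule biorthogonal_bessel_imp_generalized_dual[OF \<phi>(2) mem _ _ K])
    show "L2_inner lborel (lattice_transl \<phi> i) (lattice_transl \<psi> j) = (if i = j then 1 else 0)" for i j
      by (simp add: lattice_transl_inner \<phi> \<psi> bi lattice_quotient_eq_0_iff)
    show "(\<Sum>j\<in>F. (cmod (L2_inner lborel h (lattice_transl \<psi> j)))\<^sup>2) \<le> ?K * (L2_norm lborel h)\<^sup>2"
      if "h \<in> L2 lborel" "finite F" for h F
      by (rule orthogonal_bessel[OF mem orth K that])
  qed
  then show "oblique_dual lborel (lattice_transl \<phi>) (lattice_transl \<psi>)"
    unfolding oblique_dual_def using orthogonal_frame_seq[where g = "lattice_transl \<psi>", OF mem orth K] by blast
qed

text \<open>
  The dual generator is the component \<open>w\<close> of \<open>\<phi>\<close> restricted to \<open>Q\<close> that is orthogonal to the other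
  restricted translates, divided by \<open>\<langle>w, w\<rangle> = \<langle>\<phi>, w\<rangle>\<close>. Independence says that \<open>w\<close> is nonzero, and
  translates indexed outside \<open>A\<close> are orthogonal to it because they vanish on \<open>Q\<close>.
\<close>

lemma cell_dual_exists:
  assumes \<phi>: "\<phi> \<in> L2 lborel"
    and supp: "supported_in \<phi> ({0..2 * real n} \<times> {0..real n} \<times> {0..real M})"
    and 0: "(0, 0, 0) \<in> A_index M n"
    and indep: "\<And>c. \<not> (AE p in lborel. p \<in> Q_cell \<longrightarrow>
      \<phi> p = (\<Sum>j\<in>A_index M n - {(0, 0, 0)}. c j * lattice_transl \<phi> j p))"
  obtains d \<psi> where "\<psi> = (\<lambda>p. (\<Sum>j\<in>A_index M n. d j * lattice_transl \<phi> j p) * indicator Q_cell p)"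
    "\<psi> \<in> L2 lborel" "supported_in \<psi> Q_cell"
    "\<And>j. L2_inner lborel (lattice_transl \<phi> j) \<psi> = (if j = (0, 0, 0) then 1 else 0)"
proof -
  let ?I = "indicator Q_cell :: heis \<Rightarrow> complex" and ?F = "A_index M n - {(0, 0, 0)}"
  define v where "v = (\<lambda>j p. lattice_transl \<phi> j p * ?I p)"
  have vL: "v j \<in> L2 lborel" for j
    unfolding v_def using sets_Q_cell by (intro L2_mult_indicator lattice_transl_L2 \<phi>) auto
  have F: "finite ?F" using finite_A_index by simp
  obtain a where a: "\<And>i. i \<in> ?F \<Longrightarrow> L2_inner lborel (\<lambda>p. v (0, 0, 0) p - (\<Sum>j\<in>?F. a j * v j p)) (v i) = 0"
    using finite_span_projection[where F = ?F and v = v and u = "v (0, 0, 0)" and M = lborel] F vL by blast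
  define w where "w = (\<lambda>p. v (0, 0, 0) p - (\<Sum>j\<in>?F. a j * v j p))"
  have w_eq: "w p = (\<phi> p - (\<Sum>j\<in>?F. a j * lattice_transl \<phi> j p)) * ?I p" for p
    by (simp add: w_def v_def lattice_transl_0 left_diff_distrib sum_distrib_right mult.assoc)
  have wL: "w \<in> L2 lborel" unfolding w_def by (intro L2_diff L2_lincomb vL)
  \<comment> \<open>As \<open>w\<close> vanishes off \<open>Q\<close>, pairing with it does not see the difference between a translate and
    its restriction.\<close>
  have cut: "L2_inner lborel (lattice_transl \<phi> j) w = L2_inner lborel (v j) w" for j
    unfolding L2_inner_def v_def w_eq
    by (intro Bochner_Integration.integral_cong refl) (auto simp: indicator_def)
  have vw: "L2_inner lborel (v i) w = 0" if "i \<in> ?F" for i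
    using a[OF that] L2_inner_commute[of lborel "v i" w] by (simp add: w_def)
  have "L2_inner lborel w w = L2_inner lborel (v (0, 0, 0)) w - (\<Sum>j\<in>?F. a j * L2_inner lborel (v j) w)"
    by (subst (1) w_def)
       (simp add: L2_inner_diff_left L2_lincomb vL wL L2_inner_lincomb_left)
  then have v0: "L2_inner lborel (v (0, 0, 0)) w = L2_inner lborel w w" by (simp add: vw)
  define N where "N = L2_inner lborel w w"
  have N: "N \<noteq> 0" "cnj N = N"
  proof -
    show "cnj N = N" unfolding N_def by (rule L2_inner_commute[symmetric])
    show "N \<noteq> 0"
    proof
      assume "N = 0"
      then have "AE p in lborel. w p = 0"
        using wL by (intro L2_norm_zero_imp_AE_zero) (auto simp: N_def L2_inner_self)
      then have "AE p in lborel. p \<in> Q_cell \<longrightarrow> \<phi> p = (\<Sum>j\<in>?F. a j * lattice_transl \<phi> j p)"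
        by eventually_elim (auto simp: w_eq)
      then show False using indep by blast
    qed
  qed
  define d where "d = (\<lambda>j. (if j = (0, 0, 0) then 1 else - a j) / N)"
  define \<psi> where "\<psi> = (\<lambda>p. (\<Sum>j\<in>A_index M n. d j * lattice_transl \<phi> j p) * ?I p)"
  have \<psi>w: "\<psi> = (\<lambda>p. (1 / N) * w p)"
  proof
    fix p
    have "(\<Sum>j\<in>?F. d j * lattice_transl \<phi> j p) = (\<Sum>j\<in>?F. - (1 / N) * (a j * lattice_transl \<phi> j p))"
      by (intro sum.cong refl) (simp add: d_def)
    also have "\<dots> = - (1 / N) * (\<Sum>j\<in>?F. a j * lattice_transl \<phi> j p)"
      by (rule sum_distrib_left[symmetric])
    finally show "\<psi> p = (1 / N) * w p"
      using sum.remove[OF finite_A_index 0, of "\<lambda>j. d j * lattice_transl \<phi> j p"]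
      by (simp add: \<psi>_def w_eq lattice_transl_0 d_def diff_divide_distrib left_diff_distrib)
  qed
  have \<psi>_inner: "L2_inner lborel f \<psi> = L2_inner lborel f w / N" for f
  proof -
    have "L2_inner lborel f \<psi> = cnj (L2_inner lborel \<psi> f)" by (rule L2_inner_commute)
    also have "\<dots> = cnj (1 / N * L2_inner lborel w f)" unfolding \<psi>w by (subst L2_inner_scale_left) (rule refl)
    also have "\<dots> = 1 / N * cnj (L2_inner lborel w f)" by (simp only: complex_cnj_mult complex_cnj_divide complex_cnj_one N(2))
    finally show ?thesis by (simp only: L2_inner_commute[symmetric] times_divide_eq_left mult_1)
  qed
  have bi: "L2_inner lborel (lattice_transl \<phi> j) \<psi> = (if j = (0, 0, 0) then 1 else 0)" for j
  proof -
    consider "j = (0, 0, 0)" | "j \<in> ?F" | "j \<notin> A_index M n" by blast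
    then show ?thesis
    proof cases
      case 1
      then show ?thesis using N by (simp add: \<psi>_inner cut v0 N_def)
    next
      case 2
      then show ?thesis using vw[OF 2] by (simp add: \<psi>_inner cut)
    next
      case 3
      have "AE p in lborel. lattice_transl \<phi> j p * cnj (w p) = 0"
        using lattice_transl_zero_on_Q_cell[OF supp 3]
        by eventually_elim (auto simp: w_eq indicator_def)
      then have "L2_inner lborel (lattice_transl \<phi> j) w = 0"
        by (rule L2_inner_eq_0_AE[OF lattice_transl_L2[OF \<phi>] wL])
      with 3 0 show ?thesis by (auto simp: \<psi>_inner)
    qed
  qed
  have "\<psi> \<in> L2 lborel" unfolding \<psi>w by (rule L2_scale[OF wL])
  moreover have "supported_in \<psi> Q_cell" by (simp add: supported_in_def \<psi>_def)
  ultimately show thesis by (rule that[OF \<psi>_def _ _ bi])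
qed

theorem theorem4p2:
  fixes M n :: nat and \<phi> :: "heis \<Rightarrow> complex"
  assumes "\<phi> \<in> L2 lborel"
    and "supported_in \<phi> ({0..2 * real n} \<times> {0..real n} \<times> {0..real M})"
    and "riesz_seq lborel (lattice_transl \<phi>)"
  shows
    "let
       Q = Q_cell;
       A = A_index M n;
       dual_in_Q = (\<lambda>\<psi>. \<psi> \<in> L2 lborel \<and> supported_in \<psi> Q \<and>
         generalized_dual lborel (lattice_transl \<phi>) (lattice_transl \<psi>));
       cond_i = (\<exists>\<psi>. dual_in_Q \<psi>);
       cond_ii = (\<forall>c :: int \<times> int \<times> int \<Rightarrow> complex.
         (AE p in lborel. p \<in> Q \<longrightarrow> (\<Sum>j\<in>A. c j * lattice_transl \<phi> j p) = 0) \<longrightarrow> c (0, 0, 0) = 0);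
       cond_iii = (\<phi> \<notin> L2_span (restrict_space lborel Q) (lattice_transl \<phi>) (A - {(0, 0, 0)}))
     in
       (cond_i \<longleftrightarrow> cond_ii) \<and> (cond_ii \<longleftrightarrow> cond_iii) \<and>
       (cond_i \<or> cond_ii \<or> cond_iii \<longrightarrow>
         (\<forall>\<psi>. dual_in_Q \<psi> \<longrightarrow>
            orthogonal_seq lborel (lattice_transl \<psi>) \<and>
            oblique_dual lborel (lattice_transl \<phi>) (lattice_transl \<psi>)) \<and>
         (\<exists>\<psi>. dual_in_Q \<psi> \<and>
            (\<exists>d :: int \<times> int \<times> int \<Rightarrow> complex. AE p in lborel.
               \<psi> p = (\<Sum>j\<in>A. d j * lattice_transl \<phi> j p) * indicator Q p)))"
proof -
  note \<phi> = assms(1) and supp = assms(2) and riesz = assms(3)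
  let ?f = "lattice_transl \<phi>" and ?A = "A_index M n"
  let ?F = "?A - {(0, 0, 0)}"
  define dual where "dual = (\<lambda>\<psi>. \<psi> \<in> L2 lborel \<and> supported_in \<psi> Q_cell \<and>
    generalized_dual lborel ?f (lattice_transl \<psi>))"
  define cond_ii where "cond_ii \<longleftrightarrow> (\<forall>c :: int \<times> int \<times> int \<Rightarrow> complex.
    (AE p in lborel. p \<in> Q_cell \<longrightarrow> (\<Sum>j\<in>?A. c j * ?f j p) = 0) \<longrightarrow> c (0, 0, 0) = 0)"
  define cond_iii where "cond_iii \<longleftrightarrow> \<phi> \<notin> L2_span (restrict_space lborel Q_cell) ?f ?F"
  define special where "special = (\<lambda>\<psi>. \<exists>d :: int \<times> int \<times> int \<Rightarrow> complex. AE p in lborel.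
    \<psi> p = (\<Sum>j\<in>?A. d j * ?f j p) * indicator Q_cell p)"
  have 0: "(0, 0, 0) \<in> ?A"
    using riesz_generator_support_nondegenerate[OF assms] by (auto simp: A_index_def)
  have split_0: "(\<Sum>j\<in>?A. c j * ?f j p) = c (0, 0, 0) * \<phi> p + (\<Sum>j\<in>?F. c j * ?f j p)" for c p
    using sum.remove[OF finite_A_index 0, of "\<lambda>j. c j * ?f j p"] by (simp add: lattice_transl_0)
  have iii: "cond_iii \<longleftrightarrow> (\<nexists>c. AE p in lborel. p \<in> Q_cell \<longrightarrow> \<phi> p = (\<Sum>j\<in>?F. c j * ?f j p))"
    unfolding cond_iii_def using \<phi> sets_Q_cell finite_A_index
    by (subst L2_span_restrict_space_iff) auto
  have dual_bi: "L2_inner lborel (?f j) \<psi> = (if j = (0, 0, 0) then 1 else 0)" if "dual \<psi>" for \<psi> j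
    using generalized_dual_imp_biorthogonal[of lborel ?f "lattice_transl \<psi>" j "(0, 0, 0)"] that
    by (simp add: dual_def lattice_transl_0)
  have i_ii: cond_ii if "dual \<psi>" for \<psi>
    unfolding cond_ii_def
  proof (intro allI impI)
    fix c :: "int \<times> int \<times> int \<Rightarrow> complex"
    assume ae: "AE p in lborel. p \<in> Q_cell \<longrightarrow> (\<Sum>j\<in>?A. c j * ?f j p) = 0"
    have \<psi>: "\<psi> \<in> L2 lborel" "AE p in lborel. p \<notin> Q_cell \<longrightarrow> \<psi> p = 0"
      using that by (auto simp: dual_def supported_in_def)
    let ?s = "\<lambda>p. \<Sum>j\<in>?A. c j * ?f j p"
    have "AE p in lborel. ?s p * cnj (\<psi> p) = 0"
      using ae \<psi>(2) by eventually_elim auto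
    then have "L2_inner lborel ?s \<psi> = 0"
      by (rule L2_inner_eq_0_AE[OF L2_lincomb[OF lattice_transl_L2[OF \<phi>]] \<psi>(1)])
    moreover have "L2_inner lborel ?s \<psi> = (\<Sum>j\<in>?A. c j * (if j = (0, 0, 0) then 1 else 0))"
      by (subst L2_inner_lincomb_left) (simp_all only: lattice_transl_L2[OF \<phi>] \<psi>(1) dual_bi[OF that])
    ultimately show "c (0, 0, 0) = 0"
      using 0 finite_A_index by (simp add: if_distrib cong: if_cong)
  qed
  have ii_iii: cond_iii if cond_ii
    unfolding iii
  proof
    assume "\<exists>c. AE p in lborel. p \<in> Q_cell \<longrightarrow> \<phi> p = (\<Sum>j\<in>?F. c j * ?f j p)"
    then obtain c where c: "AE p in lborel. p \<in> Q_cell \<longrightarrow> \<phi> p = (\<Sum>j\<in>?F. c j * ?f j p)" ..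
    let ?c = "\<lambda>j. if j = (0, 0, 0) then -1 else c j"
    have "(\<Sum>j\<in>?F. ?c j * ?f j p) = (\<Sum>j\<in>?F. c j * ?f j p)" for p
      by (intro sum.cong) auto
    with c have "AE p in lborel. p \<in> Q_cell \<longrightarrow> (\<Sum>j\<in>?A. ?c j * ?f j p) = 0"
      unfolding split_0 by eventually_elim simp
    from that[unfolded cond_ii_def, rule_format, of ?c, OF this] show False by simp
  qed
  have iii_i: "\<exists>\<psi>. dual \<psi> \<and> special \<psi>" if cond_iii
  proof -
    have indep: "\<not> (AE p in lborel. p \<in> Q_cell \<longrightarrow> \<phi> p = (\<Sum>j\<in>?F. c j * ?f j p))" for c
      using that unfolding iii by blast
    obtain d \<psi> where \<psi>: "\<psi> = (\<lambda>p. (\<Sum>j\<in>?A. d j * ?f j p) * indicator Q_cell p)"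
      "\<psi> \<in> L2 lborel" "supported_in \<psi> Q_cell"
      "\<And>j. L2_inner lborel (?f j) \<psi> = (if j = (0, 0, 0) then 1 else 0)"
      by (rule cell_dual_exists[OF \<phi> supp 0 indep]) (rule that)
    have "dual \<psi>"
      using cell_dual_properties(2)[OF \<phi> riesz \<psi>(2-4)] \<psi>(2,3) by (simp add: dual_def oblique_dual_def)
    moreover have "special \<psi>"
      unfolding special_def by (intro exI[of _ d]) (simp add: \<psi>(1))
    ultimately show ?thesis by blast
  qed
  have "orthogonal_seq lborel (lattice_transl \<psi>) \<and> oblique_dual lborel ?f (lattice_transl \<psi>)"
    if "dual \<psi>" for \<psi>
    using cell_dual_properties[OF \<phi> riesz _ _ dual_bi[OF that]] that by (simp add: dual_def)
  with i_ii ii_iii iii_i have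
    "((\<exists>\<psi>. dual \<psi>) \<longleftrightarrow> cond_ii) \<and> (cond_ii \<longleftrightarrow> cond_iii) \<and>
     ((\<exists>\<psi>. dual \<psi>) \<or> cond_ii \<or> cond_iii \<longrightarrow>
       (\<forall>\<psi>. dual \<psi> \<longrightarrow>
          orthogonal_seq lborel (lattice_transl \<psi>) \<and> oblique_dual lborel ?f (lattice_transl \<psi>)) \<and>
       (\<exists>\<psi>. dual \<psi> \<and> special \<psi>))"
    by blast
  then show ?thesis
    unfolding dual_def cond_ii_def cond_iii_def special_def Let_def .
qed

end
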